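(* Let $p=(p_n)$ and $q=(q_n)$ be any sequences of non-negative integers with $p_n<q_n$ for each $n$ and $q_n\to\infty$. If the sequence $\big(\frac{p_n}{q_n-p_n}\big)$ is bounded, then statistical order convergence implies deferred statistical order convergence; that is, for every Riesz space $E$, every sequence $(x_n)$ in $E$ and every $x\in E$, if $x_n\xrightarrow{st_o}x$ then $x_n\xrightarrow{D_{st_o}(p,q)}x$.
   Context: A Riesz space (vector lattice) is a real ordered vector space in which any two elements have a supremum and an infimum; $|x|:=x\vee(-x)$. For $K=\{k_1<k_2<\cdots\}\subseteq\mathbb{N}$, $(z_{k})_{k\in K}\downarrow 0$ means $z_{k_1}\ge z_{k_2}\ge\cdots$ and $\inf_{k\in K}z_k=0$ in $E$. The natural density of $K\subseteq\mathbb{N}$ is $\delta(K):=\lim_{n\to\infty}\frac1n|\{k\le n:k\in K\}|$ and the deferred density is $\delta_{p,q}(K):=\lim_{n\to\infty}\frac{1}{q_n-p_n}\big|\{k: p_n<k\le q_n,\ k\in K\}\big|$, when these limits exist. A sequence $(x_n)$ in $E$ is statistical order convergent to $x\in E$, written $x_n\xrightarrow{st_o}x$, if there exist a sequence $(z_n)$ in $E$ and a set $K\subseteq\mathbb{N}$ with $\delta(K)=1$, $(z_k)_{k\in K}\downarrow 0$, and $|x_k-x|\le z_k$ for all $k\in K$. It is deferred statistical order convergent to $x$, written $x_n\xrightarrow{D_{st_o}(p,q)}x$, if there exist a sequence $(z_n)$ in $E$ and a set $K\subseteq\mathbb{N}$ with $\delta_{p,q}(K)=1$, $(z_k)_{k\in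 K}\downarrow 0$, and $|x_k-x|\le z_k$ for all $k\in K$. *)

theory Defs
  imports "HOL-Analysis.Analysis" "HOL-Library.Lattice_Algebras" "HOL-Library.Lub_Glb"
begin

text \<open>
  A Riesz space is an ordered real vector space whose order is a lattice.  The class
  \<open>lattice_ab_group_add_abs\<close> contributes no structure beyond the lattice and the notation for
  the modulus, which it fixes by the axiom \<open>\<bar>a\<bar> = sup a (- a)\<close>.
\<close>

class riesz_space = ordered_real_vector + lattice_ab_group_add_abs

text \<open>
  Sequences are indexed by the positive integers: they are functions on \<open>nat\<close> whose value at 0
  is never used, and the index sets \<open>K\<close> below are sets of positive integers.  Each of the two
  density predicates says that the density exists and is equal to \<open>d\<close>.
\<close>

definition has_natural_density :: "nat set \<Rightarrow> real \<Rightarrow> bool" where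
  "has_natural_density K d \<longleftrightarrow>
     (\<lambda>n. real (card {k \<in> K. 1 \<le> k \<and> k \<le> n}) / real n) \<longlonglongrightarrow> d"

definition has_deferred_density ::
    "(nat \<Rightarrow> nat) \<Rightarrow> (nat \<Rightarrow> nat) \<Rightarrow> nat set \<Rightarrow> real \<Rightarrow> bool" where
  "has_deferred_density p q K d \<longleftrightarrow>
     (\<lambda>n. real (card {k \<in> K. p n < k \<and> k \<le> q n}) / (real (q n) - real (p n))) \<longlonglongrightarrow> d"

definition decreases_to_zero_on :: "nat set \<Rightarrow> (nat \<Rightarrow> 'a::riesz_space) \<Rightarrow> bool" where
  "decreases_to_zero_on K z \<longleftrightarrow>
     (\<forall>i\<in>K. \<forall>j\<in>K. i \<le> j \<longrightarrow> z j \<le> z i) \<and> isGlb UNIV (z ` K) 0"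

definition stat_order_convergent :: "(nat \<Rightarrow> 'a::riesz_space) \<Rightarrow> 'a \<Rightarrow> bool" where
  "stat_order_convergent x l \<longleftrightarrow>
     (\<exists>z K. K \<subseteq> {1..} \<and> has_natural_density K 1 \<and> decreases_to_zero_on K z \<and>
        (\<forall>k\<in>K. \<bar>x k - l\<bar> \<le> z k))"

definition deferred_stat_order_convergent ::
    "(nat \<Rightarrow> nat) \<Rightarrow> (nat \<Rightarrow> nat) \<Rightarrow> (nat \<Rightarrow> 'a::riesz_space) \<Rightarrow> 'a \<Rightarrow> bool" where
  "deferred_stat_order_convergent p q x l \<longleftrightarrow>
     (\<exists>z K. K \<subseteq> {1..} \<and> has_deferred_density p q K 1 \<and> decreases_to_zero_on K z \<and>
        (\<forall>k\<in>K. \<bar>x k - l\<bar> \<le> z k))"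

end

theory Submission
  imports Defs
begin

text \<open>
  The witnesses of statistical order convergence, the majorant \<open>z\<close> and the index set \<open>K\<close>, also
  witness deferred statistical order convergence: only the meaning of ``\<open>K\<close> has density one''
  changes.  So the theorem is a statement about sets of integers.  The indices
  missing from \<open>K\<close> in the window from \<open>p n\<close> to \<open>q n\<close> are among those missing up to \<open>q n\<close>, and
  there are \<open>o(q n)\<close> of the latter because \<open>q n\<close> tends to infinity.  The window has length
  \<open>q n - p n\<close>, and \<open>q n / (q n - p n) = 1 + p n / (q n - p n)\<close> is bounded by hypothesis, so that
  the missing indices are also \<open>o(q n - p n)\<close>.
\<close>

text \<open>
  For \<open>p \<le> q\<close> the two sides count the integers that \<open>K\<close> misses in \<open>{p<..q}\<close> and in \<open>{1..q}\<close>.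
  The inequality holds because \<open>K\<close> has at most \<open>p\<close> elements in \<open>{1..p}\<close>.
\<close>

lemma missed_in_window_le_missed:
  "(real q - real p) - real (card {k \<in> K. p < k \<and> k \<le> q})
     \<le> real q - real (card {k \<in> K. 1 \<le> k \<and> k \<le> q})"
proof -
  have "{k \<in> K. 1 \<le> k \<and> k \<le> q} \<subseteq> {1..p} \<union> {k \<in> K. p < k \<and> k \<le> q}"
    by auto
  then have "card {k \<in> K. 1 \<le> k \<and> k \<le> q} \<le> card ({1..p} \<union> {k \<in> K. p < k \<and> k \<le> q})"
    by (intro card_mono) auto
  also have "\<dots> \<le> p + card {k \<in> K. p < k \<and> k \<le> q}"
    using card_Un_le[of "{1..p}"] by simp
  finally show ?thesis
    by linarith
qed

lemma card_window_le:
  assumes "p \<le> q"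
  shows "real (card {k \<in> K. p < k \<and> k \<le> q}) \<le> real q - real p"
proof -
  have "card {k \<in> K. p < k \<and> k \<le> q} \<le> card {p<..q}"
    by (intro card_mono) auto
  then show ?thesis
    using assms by simp
qed

text \<open>
  With \<open>p n / (q n - p n) \<le> M\<close>, the proportion of a window that \<open>K\<close> misses is at most \<open>1 + M\<close>
  times the proportion that it misses up to \<open>q n\<close>.
\<close>

lemma natural_density_one_imp_deferred_density_one:
  assumes less: "\<And>n. n \<ge> 1 \<Longrightarrow> p n < q n"
    and q_top: "filterlim q at_top sequentially"
    and bdd: "bounded ((\<lambda>n. real (p n) / (real (q n) - real (p n))) ` {1..})"
    and dens: "has_natural_density K 1"
  shows "has_deferred_density p q K 1"
proof -
  define a where "a m = real (card {k \<in> K. 1 \<le> k \<and> k \<le> m})" for m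
  define w where "w n = real (card {k \<in> K. p n < k \<and> k \<le> q n})" for n
  define L where "L n = real (q n) - real (p n)" for n
  obtain M where M: "real (p n) / L n \<le> M" if "n \<ge> 1" for n
    using bdd unfolding bounded_iff L_def by (force simp: abs_le_iff)
  have "(\<lambda>n. a (q n) / real (q n)) \<longlonglongrightarrow> 1"
    using filterlim_compose[OF _ q_top] dens unfolding has_natural_density_def a_def by blast
  then have "(\<lambda>n. (1 + M) * (1 - a (q n) / real (q n))) \<longlonglongrightarrow> (1 + M) * (1 - 1)"
    by (intro tendsto_intros)
  then have lim: "(\<lambda>n. (1 + M) * (1 - a (q n) / real (q n))) \<longlonglongrightarrow> 0"
    by simp
  have bound: "norm (w n / L n - 1) \<le> (1 + M) * (1 - a (q n) / real (q n))" if n: "n \<ge> 1" for n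
  proof -
    have L: "L n > 0" and q: "real (q n) > 0"
      using less[OF n] by (auto simp: L_def)
    have w: "w n \<le> L n"
      unfolding w_def L_def using less[OF n] by (intro card_window_le) simp
    have missed: "L n - w n \<le> real (q n) - a (q n)"
      unfolding w_def L_def a_def by (rule missed_in_window_le_missed)
    have "norm (w n / L n - 1) = (L n - w n) / L n"
      using w L by (simp add: abs_if field_simps)
    also have "\<dots> \<le> (real (q n) - a (q n)) / L n"
      using missed L by (simp add: divide_right_mono)
    also have "\<dots> = real (q n) / L n * (1 - a (q n) / real (q n))"
      using q L by (simp add: field_simps)
    also have "\<dots> \<le> (1 + M) * (1 - a (q n) / real (q n))"
    proof (rule mult_right_mono)
      have "real (q n) / L n = 1 + real (p n) / L n"
        using L by (simp add: L_def field_simps)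
      then show "real (q n) / L n \<le> 1 + M"
        using M[OF n] by simp
      show "0 \<le> 1 - a (q n) / real (q n)"
        using missed w q by (simp add: field_simps)
    qed
    finally show ?thesis .
  qed
  have "(\<lambda>n. w n / L n - 1) \<longlonglongrightarrow> 0"
    using lim by (rule Lim_null_comparison[rotated])
      (use bound in \<open>auto simp: eventually_sequentially\<close>)
  then show ?thesis
    unfolding has_deferred_density_def w_def L_def by (simp add: LIM_zero_iff)
qed

theorem theorem3p14:
  fixes p q :: "nat \<Rightarrow> nat" and x :: "nat \<Rightarrow> 'a::riesz_space" and l :: 'a
  assumes "\<And>n. n \<ge> 1 \<Longrightarrow> p n < q n"
    and "filterlim q at_top sequentially"
    and "bounded ((\<lambda>n. real (p n) / (real (q n) - real (p n))) ` {1..})"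
    and "stat_order_convergent x l"
  shows "deferred_stat_order_convergent p q x l"
  using assms(4) natural_density_one_imp_deferred_density_one[OF assms(1-3)]
  unfolding stat_order_convergent_def deferred_stat_order_convergent_def by blast

end
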